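(* For $n=21$ there exist upward closed set systems $X,Y,Z\subset Q_{21}$ with $|X|=|Y|=|Z|$ such that $$\frac{|S_1|}{2^{21}}>0.447>\frac49,$$ where $S_1=(X\cap Y^c\cap Z^c)\sqcup (X^c\cap Y\cap Z^c)\sqcup (X^c\cap Y^c\cap Z)$ is the set of points of $Q_{21}$ lying in exactly one of $X,Y,Z$. In particular, it is not true that for every $n$ and all upward closed $X,Y,Z\subset Q_n$ with $|X|=|Y|=|Z|$, the set of points in exactly one of $X,Y,Z$ has size at most $\frac49\cdot 2^n$.
   Context: $Q_n$ denotes the power set of $[n]=\{1,2,\dots,n\}$, ordered by inclusion. A set system $X\subset Q_n$ is upward closed if whenever $A\in X$ and $A\subset B\subset [n]$, also $B\in X$. Complements are taken in $Q_n$. *)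

theory Defs
  imports Complex_Main
begin

definition Q :: "nat \<Rightarrow> nat set set" where
  "Q n = Pow {1..n}"

definition upward_closed :: "nat \<Rightarrow> nat set set \<Rightarrow> bool" where
  "upward_closed n X \<longleftrightarrow>
     X \<subseteq> Q n \<and> (\<forall>A B. A \<in> X \<and> A \<subseteq> B \<and> B \<subseteq> {1..n} \<longrightarrow> B \<in> X)"

definition compl_in :: "nat \<Rightarrow> nat set set \<Rightarrow> nat set set" where
  "compl_in n X = Q n - X"

definition exactly_one ::
    "nat \<Rightarrow> nat set set \<Rightarrow> nat set set \<Rightarrow> nat set set \<Rightarrow> nat set set" where
  "exactly_one n X Y Z =
     (X \<inter> compl_in n Y \<inter> compl_in n Z) \<union>
     (compl_in n X \<inter> Y \<inter> compl_in n Z) \<union>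
     (compl_in n X \<inter> compl_in n Y \<inter> Z)"

end

theory Submission
  imports Defs
begin

text \<open>
  The value \<open>4/9\<close> is what three independent families of density \<open>1/3\<close> give. Equality of
  the three cardinalities does not force the three families to play the same role, and an
  asymmetric choice is better. Let \<open>X\<close> and \<open>Y\<close> be independent of density \<open>p\<close>, and let
  \<open>Z = (X \<inter> Y) \<union> W\<close> with \<open>W\<close> independent of both. The points of \<open>X \<inter> Y\<close> lie in more than one
  family anyway, so they help \<open>Z\<close> to reach density \<open>p\<close> at no cost; what remains
  is \<open>W\<close> of density \<open>w\<close> with \<open>w (1 - p\<^sup>2) = p - p\<^sup>2\<close>, that is \<open>w = p / (1 + p)\<close>.
  The density of the points in exactly one family is then
  \<open>2 p (1 - p) (1 - w) + (1 - p)\<^sup>2 w = p (1 - p) (3 - p) / (1 + p)\<close>, which is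
  \<open>4/9\<close> at \<open>p = 1/3\<close> but still increasing there, with maximum about \<open>0.4475\<close> near \<open>p = 0.37\<close>.

  The proof takes \<open>p = 3/8\<close>, realised on two disjoint blocks of three coordinates, which leaves a
  block of \<open>15\<close> coordinates for \<open>W\<close>. The ideal density \<open>w = 3/11\<close> is not dyadic, so \<open>W\<close> is
  replaced by two nested families: \<open>W1\<close> outside \<open>X \<union> Y\<close>, and a slightly larger
  \<open>W2\<close> on the points in exactly one of \<open>X\<close> and \<open>Y\<close>. With \<open>a = |W1|\<close> and \<open>b = |W2|\<close>, the
  condition \<open>|Z| = |X|\<close> reads \<open>9 \<cdot> 2\<^sup>1\<^sup>5 + 30 b + 25 a = 24 \<cdot> 2\<^sup>1\<^sup>5\<close>, i.e.
  \<open>5 a + 6 b = 3 \<cdot> 2\<^sup>1\<^sup>5\<close>. Its solution with \<open>a \<le> b\<close> and \<open>b - a\<close> smallest is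
  \<open>a = 8934\<close>, \<open>b = 8939\<close>, and the number of points in exactly one family is
  \<open>30 (2\<^sup>1\<^sup>5 - b) + 25 a = 938220 > 0.447 \<cdot> 2\<^sup>2\<^sup>1\<close>.
  Upward closed families of any prescribed sizes, nested in each other, exist because
  minimal members can be removed one at a time (\<open>up_closed_subfamily\<close>); the cardinalities
  are products over the three blocks (\<open>card_box\<close>).
\<close>

section \<open>Upward closed families of prescribed size\<close>

definition up_closed_on :: "'a set \<Rightarrow> 'a set set \<Rightarrow> bool" where
  "up_closed_on S F \<longleftrightarrow> F \<subseteq> Pow S \<and> (\<forall>A\<in>F. \<forall>B. A \<subseteq> B \<and> B \<subseteq> S \<longrightarrow> B \<in> F)"

lemma up_closed_on_Pow: "up_closed_on S (Pow S)"
  by (auto simp: up_closed_on_def)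

text \<open>
  A member of least cardinality is minimal under inclusion, so removing it keeps the family
  upward closed; iterating this reaches every smaller size.
\<close>
lemma up_closed_subfamily:
  assumes "finite S" "up_closed_on S F" "t \<le> card F"
  shows "\<exists>F' \<subseteq> F. up_closed_on S F' \<and> card F' = t"
  using assms(3)
proof (induction rule: inc_induct)
  case base
  then show ?case using assms(2) by blast
next
  case (step m)
  then obtain F' where F': "F' \<subseteq> F" "up_closed_on S F'" "card F' = Suc m"
    by blast
  have finF': "finite F'" using F'(3) by (metis card.infinite nat.distinct(1))
  have "F' \<noteq> {}" using F'(3) by auto
  then obtain A where A: "A \<in> F'" "\<forall>B\<in>F'. card A \<le> card B"
    using ex_min_if_finite[of "card ` F'"] finF'
    by (metis arg_min_if_finite(1) arg_min_least)
  have "up_closed_on S (F' - {A})"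
    unfolding up_closed_on_def
  proof (intro conjI ballI allI impI)
    show "F' - {A} \<subseteq> Pow S" using F'(2) by (auto simp: up_closed_on_def)
  next
    fix C B assume C: "C \<in> F' - {A}" and B: "C \<subseteq> B \<and> B \<subseteq> S"
    have "B \<in> F'" using C B F'(2) by (auto simp: up_closed_on_def)
    moreover have "B \<noteq> A"
    proof
      assume "B = A"
      hence "C \<subset> A" using B C by auto
      moreover have "finite A" using \<open>B = A\<close> B assms(1) finite_subset by blast
      ultimately have "card C < card A" by (rule psubset_card_mono[rotated])
      thus False using A(2) C by force
    qed
    ultimately show "B \<in> F' - {A}" by simp
  qed
  moreover have "card (F' - {A}) = m" using F'(3) A(1) by simp
  moreover have "F' - {A} \<subseteq> F" using F'(1) by blast
  ultimately show ?case by blast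
qed

lemma up_closed_of_card:
  assumes "finite S" "t \<le> 2 ^ card S"
  shows "\<exists>F. up_closed_on S F \<and> card F = t"
  using up_closed_subfamily[OF assms(1) up_closed_on_Pow, of t] assms by (auto simp: card_Pow)

section \<open>Counting over three blocks of coordinates\<close>

definition block1 :: "nat set" where "block1 = {1..3}"
definition block2 :: "nat set" where "block2 = {4..6}"
definition block3 :: "nat set" where "block3 = {7..21}"

lemma block_facts:
  "finite block1" "finite block2" "finite block3"
  "card block1 = 3" "card block2 = 3" "card block3 = 15"
  by (simp_all add: block1_def block2_def block3_def)

lemma block_partition:
  "{1..21} = block1 \<union> block2 \<union> block3"
  "block1 \<inter> block2 = {}" "block1 \<inter> block3 = {}" "block2 \<inter> block3 = {}"
  by (auto simp: block1_def block2_def block3_def)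

definition box :: "nat set set \<Rightarrow> nat set set \<Rightarrow> nat set set \<Rightarrow> nat set set" where
  "box F G H = {A \<in> Q 21. A \<inter> block1 \<in> F \<and> A \<inter> block2 \<in> G \<and> A \<inter> block3 \<in> H}"

lemma finite_box: "finite (box F G H)"
  by (rule finite_subset[of _ "Pow {1..21}"]) (auto simp: box_def Q_def)

lemma card_box:
  assumes "F \<subseteq> Pow block1" "G \<subseteq> Pow block2" "H \<subseteq> Pow block3"
  shows "card (box F G H) = card F * card G * card H"
proof -
  have "bij_betw (\<lambda>A. (A \<inter> block1, A \<inter> block2, A \<inter> block3)) (box F G H) (F \<times> G \<times> H)"
  proof (rule bij_betw_byWitness[where f' = "\<lambda>(a, b, c). a \<union> b \<union> c"])
    show "\<forall>A\<in>box F G H. (\<lambda>(a, b, c). a \<union> b \<union> c) (A \<inter> block1, A \<inter> block2, A \<inter> block3) = A"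
      unfolding box_def Q_def block_partition(1) by blast
    have abc: "(a \<union> b \<union> c) \<inter> block1 = a" "(a \<union> b \<union> c) \<inter> block2 = b"
         "(a \<union> b \<union> c) \<inter> block3 = c" "a \<union> b \<union> c \<in> Q 21"
      if "a \<in> F" "b \<in> G" "c \<in> H" for a b c
    proof -
      have "a \<subseteq> block1" "b \<subseteq> block2" "c \<subseteq> block3" using that assms by auto
      then show "(a \<union> b \<union> c) \<inter> block1 = a" "(a \<union> b \<union> c) \<inter> block2 = b"
         "(a \<union> b \<union> c) \<inter> block3 = c" "a \<union> b \<union> c \<in> Q 21"
        using block_partition(2-4) unfolding Q_def block_partition(1) by blast+
    qed
    show "\<forall>x\<in>F \<times> G \<times> H. (\<lambda>A. (A \<inter> block1, A \<inter> block2, A \<inter> block3))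
            ((\<lambda>(a, b, c). a \<union> b \<union> c) x) = x"
      using abc by auto
    show "(\<lambda>A. (A \<inter> block1, A \<inter> block2, A \<inter> block3)) ` box F G H \<subseteq> F \<times> G \<times> H"
      by (auto simp: box_def)
    show "(\<lambda>(a, b, c). a \<union> b \<union> c) ` (F \<times> G \<times> H) \<subseteq> box F G H"
      using abc by (auto simp: box_def)
  qed
  then show ?thesis
    by (simp add: bij_betw_same_card card_cartesian_product)
qed

lemma upward_closed_of_mono:
  assumes "\<And>A. A \<in> X \<longleftrightarrow> A \<in> Q n \<and> P A"
    and "\<And>A B. A \<subseteq> B \<Longrightarrow> B \<subseteq> {1..n} \<Longrightarrow> P A \<Longrightarrow> P B"
  shows "upward_closed n X"
  unfolding upward_closed_def using assms by (auto simp: Q_def)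

lemma up_closed_on_Int_mono:
  assumes "up_closed_on S F" "A \<inter> S \<in> F" "A \<subseteq> B"
  shows "B \<inter> S \<in> F"
  using assms unfolding up_closed_on_def by (meson Int_lower2 Int_mono order_refl)

section \<open>The three families\<close>

lemma asymmetric_families:
  obtains X Y Z where
    "upward_closed 21 X" "upward_closed 21 Y" "upward_closed 21 Z"
    "card X = 786432" "card Y = 786432" "card Z = 786432"
    "card (exactly_one 21 X Y Z) = 938220"
proof -
  obtain F where F: "up_closed_on block1 F" "card F = 3"
    using up_closed_of_card[of block1 3] by (auto simp: block_facts)
  obtain G where G: "up_closed_on block2 G" "card G = 3"
    using up_closed_of_card[of block2 3] by (auto simp: block_facts)
  obtain W2 where W2: "up_closed_on block3 W2" "card W2 = 8939"
    using up_closed_of_card[of block3 8939] by (auto simp: block_facts)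
  obtain W1 where W1: "up_closed_on block3 W1" "card W1 = 8934" and W12: "W1 \<subseteq> W2"
    using up_closed_subfamily[OF block_facts(3) W2(1), of 8934] W2(2) by auto
  let ?F' = "Pow block1 - F" and ?G' = "Pow block2 - G" and ?W2' = "Pow block3 - W2"
  have sub: "F \<subseteq> Pow block1" "G \<subseteq> Pow block2" "W1 \<subseteq> Pow block3" "W2 \<subseteq> Pow block3"
    using F G W1 W2 by (auto simp: up_closed_on_def)
  have compl_cards: "card ?F' = 5" "card ?G' = 5" "card ?W2' = 23829"
    using F(2) G(2) W2(2) sub by (simp_all add: card_Diff_subset finite_subset[OF sub(1)]
        finite_subset[OF sub(2)] finite_subset[OF sub(4)] card_Pow block_facts)
  define X where "X = box F (Pow block2) (Pow block3)"
  define Y where "Y = box (Pow block1) G (Pow block3)"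
  define Z where "Z = box F G (Pow block3) \<union> box F ?G' W2 \<union> box ?F' G W2 \<union> box ?F' ?G' W1"

  have memX: "A \<in> X \<longleftrightarrow> A \<in> Q 21 \<and> A \<inter> block1 \<in> F" for A
    by (auto simp: X_def box_def)
  have memY: "A \<in> Y \<longleftrightarrow> A \<in> Q 21 \<and> A \<inter> block2 \<in> G" for A
    by (auto simp: Y_def box_def)
  \<comment> \<open>\<open>W1 \<subseteq> W2\<close> turns the four disjoint pieces of \<open>Z\<close> into a visibly monotone condition.\<close>
  have memZ: "A \<in> Z \<longleftrightarrow> A \<in> Q 21 \<and>
      (A \<inter> block1 \<in> F \<and> A \<inter> block2 \<in> G \<or>
       (A \<inter> block1 \<in> F \<or> A \<inter> block2 \<in> G) \<and> A \<inter> block3 \<in> W2 \<or>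
       A \<inter> block3 \<in> W1)" for A
    using W12 by (auto simp: Z_def box_def)
  note mono = up_closed_on_Int_mono[OF F(1)] up_closed_on_Int_mono[OF G(1)]
    up_closed_on_Int_mono[OF W1(1)] up_closed_on_Int_mono[OF W2(1)]
  have upX: "upward_closed 21 X"
    by (rule upward_closed_of_mono[OF memX]) (rule mono(1))
  have upY: "upward_closed 21 Y"
    by (rule upward_closed_of_mono[OF memY]) (rule mono(2))
  have upZ: "upward_closed 21 Z"
  proof (rule upward_closed_of_mono[OF memZ], goal_cases)
    case (1 A B)
    note m = mono[OF _ 1(1)]
    from 1(3) show ?case using m by blast
  qed

  have cardX: "card X = 786432"
    unfolding X_def using F(2) sub by (subst card_box) (auto simp: card_Pow block_facts)
  have cardY: "card Y = 786432"
    unfolding Y_def using G(2) sub by (subst card_box) (auto simp: card_Pow block_facts)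
  have "card Z = card (box F G (Pow block3)) + card (box F ?G' W2)
      + card (box ?F' G W2) + card (box ?F' ?G' W1)"
    unfolding Z_def
    by (subst card_Un_disjoint, simp add: finite_box, simp add: finite_box, force simp: box_def)+
       simp
  also have "\<dots> = 786432"
    using sub F(2) G(2) W1(2) W2(2) by (simp add: card_box compl_cards card_Pow block_facts)
  finally have cardZ: "card Z = 786432" .

  have "exactly_one 21 X Y Z = box F ?G' ?W2' \<union> box ?F' G ?W2' \<union> box ?F' ?G' W1"
    using W12 unfolding exactly_one_def compl_in_def
    by (auto simp: memX memY memZ box_def)
  hence "card (exactly_one 21 X Y Z) =
      card (box F ?G' ?W2') + card (box ?F' G ?W2') + card (box ?F' ?G' W1)"
    by (simp only:)
      ((subst card_Un_disjoint, simp add: finite_box, simp add: finite_box,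
        force simp: box_def)+, simp)
  also have "\<dots> = 938220"
    using sub F(2) G(2) W1(2) by (simp add: card_box compl_cards)
  finally have "card (exactly_one 21 X Y Z) = 938220" .
  with upX upY upZ cardX cardY cardZ show ?thesis by (rule that)
qed

theorem mainTheorem2:
  shows "(\<exists>X Y Z.
            upward_closed 21 X \<and> upward_closed 21 Y \<and> upward_closed 21 Z \<and>
            card X = card Y \<and> card Y = card Z \<and>
            real (card (exactly_one 21 X Y Z)) / 2 ^ 21 > 0.447) \<and>
         (0.447 :: real) > 4 / 9 \<and>
         \<not> (\<forall>n X Y Z.
            upward_closed n X \<and> upward_closed n Y \<and> upward_closed n Z \<and>
            card X = card Y \<and> card Y = card Z \<longrightarrow>
            real (card (exactly_one n X Y Z)) \<le> 4 / 9 * 2 ^ n)"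
proof -
  obtain X Y Z where XYZ:
    "upward_closed 21 X" "upward_closed 21 Y" "upward_closed 21 Z"
    "card X = 786432" "card Y = 786432" "card Z = 786432"
    "card (exactly_one 21 X Y Z) = 938220"
    by (rule asymmetric_families)
  have "real (card (exactly_one 21 X Y Z)) / 2 ^ 21 > 0.447"
    by (simp add: XYZ)
  moreover have "\<not> real (card (exactly_one 21 X Y Z)) \<le> 4 / 9 * 2 ^ 21"
    by (simp add: XYZ)
  ultimately show ?thesis using XYZ(1-6) by (intro conjI) (metis, simp, metis)
qed

end
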